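(* Let $a$ be a non-negative integer. For every integer $m$ with $0\leq m\leq a$, we have $$M_{\mathcal{A}}(\{1\}^{a+2};\{1\}^{a-m+1},\{-1\}^{m+1})=(-1)^{m+1}\binom{a+2}{m+1}E_{\mathcal{A}}(\{1\}^{a+2})$$ and $$M_{\mathcal{A}}(\{1\}^{a+2};\{1\}^{a-m+1},\{-1\}^{m+1})=(-1)^{a+m+1}\binom{a+2}{m+1}t_{\mathcal{A}}(\{1\}^{a+2}).$$
   Context: Let $\mathcal{P}$ be the set of primes and $\mathcal{A}:=\prod_{p\in\mathcal{P}}(\mathbb{Z}/p\mathbb{Z})\big/\bigoplus_{p\in\mathcal{P}}(\mathbb{Z}/p\mathbb{Z})$, in which an element is determined by its components at all but finitely many primes. For positive integers $k_1,\ldots,k_r$, signs $\varepsilon_1,\ldots,\varepsilon_r\in\{\pm1\}$ and a positive integer $N$, put $$M_N(k_1,\ldots,k_r;\varepsilon_1,\ldots,\varepsilon_r):=\sum_{0<m_1<\cdots<m_r<N}\frac{(1+\varepsilon_1(-1)^{m_1})\cdots(1+\varepsilon_r(-1)^{m_r})}{m_1^{k_1}\cdots m_r^{k_r}},$$ and define the finite multiple mixed value $M_{\mathcal{A}}(k_1,\ldots,k_r;\varepsilon_1,\ldots,\varepsilon_r):=\bigl(M_p(k_1,\ldots,k_r;\varepsilon_1,\ldots,\varepsilon_r)\bmod p\bigr)_{p\in\mathcal{P}}\in\mathcal{A}$. The symbol $\{c\}^n$ denotes the string $c,\ldots,c$ with $n$ repetitions. The finite multiple $E$- and $t$-values are $E_{\mathcal{A}}(k_1,\ldots,k_r):=M_{\mathcal{A}}(k_1,\ldots,k_r;\{1\}^r)$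 and $t_{\mathcal{A}}(k_1,\ldots,k_r):=M_{\mathcal{A}}(k_1,\ldots,k_r;\{-1\}^r)$. *)

theory Defs
  imports "HOL-Algebra.QuotRing" "HOL-Number_Theory.Number_Theory"
begin

subsection \<open>Products of rings modulo direct sums\<close>

definition product_ring :: "'i set \<Rightarrow> ('i \<Rightarrow> 'a ring) \<Rightarrow> ('i \<Rightarrow> 'a) ring" where
  "product_ring I R =
    \<lparr>carrier = (\<Pi>\<^sub>E i\<in>I. carrier (R i)),
     monoid.mult = (\<lambda>f g. \<lambda>i\<in>I. f i \<otimes>\<^bsub>R i\<^esub> g i),
     one = (\<lambda>i\<in>I. \<one>\<^bsub>R i\<^esub>),
     zero = (\<lambda>i\<in>I. \<zero>\<^bsub>R i\<^esub>),
     add = (\<lambda>f g. \<lambda>i\<in>I. f i \<oplus>\<^bsub>R i\<^esub> g i)\<rparr>"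

definition direct_sum :: "'i set \<Rightarrow> ('i \<Rightarrow> 'a ring) \<Rightarrow> ('i \<Rightarrow> 'a) set" where
  "direct_sum I R =
    {f \<in> carrier (product_ring I R). finite {i \<in> I. f i \<noteq> \<zero>\<^bsub>R i\<^esub>}}"

lemma cring_product_ring:
  assumes "\<And>i. i \<in> I \<Longrightarrow> cring (R i)"
  shows "cring (product_ring I R)"
proof (rule cringI)
  have r: "ring (R i)" if "i \<in> I" for i
    using assms[OF that] by (rule cring.axioms)
  note ring.ring_simprules[OF r, simp]
  show "abelian_group (product_ring I R)"
  proof (rule abelian_groupI)
    fix x assume x: "x \<in> carrier (product_ring I R)"
    show "\<exists>y\<in>carrier (product_ring I R). y \<oplus>\<^bsub>product_ring I R\<^esub> x = \<zero>\<^bsub>product_ring I R\<^esub>"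
      by (rule bexI[where x = "\<lambda>i\<in>I. \<ominus>\<^bsub>R i\<^esub> x i"])
        (use x in \<open>auto simp: product_ring_def PiE_iff intro!: restrict_ext\<close>)
  next
    fix x assume x: "x \<in> carrier (product_ring I R)"
    show "\<zero>\<^bsub>product_ring I R\<^esub> \<oplus>\<^bsub>product_ring I R\<^esub> x = x"
      using x by (auto simp: product_ring_def PiE_iff extensional_def fun_eq_iff)
  qed (auto simp: product_ring_def PiE_iff intro!: restrict_ext)
  show "comm_monoid (product_ring I R)"
  proof (rule comm_monoidI)
    fix x assume x: "x \<in> carrier (product_ring I R)"
    show "\<one>\<^bsub>product_ring I R\<^esub> \<otimes>\<^bsub>product_ring I R\<^esub> x = x"
      using x by (auto simp: product_ring_def PiE_iff extensional_def fun_eq_iff)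
  qed (auto simp: product_ring_def PiE_iff cring.cring_simprules[OF assms] intro!: restrict_ext)
qed (auto simp: product_ring_def PiE_iff cring.cring_simprules[OF assms] intro!: restrict_ext)

lemma ideal_direct_sum:
  assumes "\<And>i. i \<in> I \<Longrightarrow> cring (R i)"
  shows "ideal (direct_sum I R) (product_ring I R)"
proof -
  interpret P: cring "product_ring I R"
    by (rule cring_product_ring) (rule assms)
  have r: "ring (R i)" if "i \<in> I" for i
    using assms[OF that] by (rule cring.axioms)
  note ring.ring_simprules[OF r, simp]
  let ?S = "\<lambda>f. {i \<in> I. f i \<noteq> \<zero>\<^bsub>R i\<^esub>}"
  have carr: "f i \<in> carrier (R i)" if "f \<in> carrier (product_ring I R)" "i \<in> I" for f i
    using that by (auto simp: product_ring_def)
  have add: "(f \<oplus>\<^bsub>product_ring I R\<^esub> g) i = f i \<oplus>\<^bsub>R i\<^esub> g i" if "i \<in> I" for f g i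
    using that by (simp add: product_ring_def)
  have mult: "(f \<otimes>\<^bsub>product_ring I R\<^esub> g) i = f i \<otimes>\<^bsub>R i\<^esub> g i" if "i \<in> I" for f g i
    using that by (simp add: product_ring_def)
  have zero: "\<zero>\<^bsub>product_ring I R\<^esub> i = \<zero>\<^bsub>R i\<^esub>" if "i \<in> I" for i
    using that by (simp add: product_ring_def)
  have neg: "(\<ominus>\<^bsub>product_ring I R\<^esub> f) i = \<ominus>\<^bsub>R i\<^esub> f i"
    if f: "f \<in> carrier (product_ring I R)" and i: "i \<in> I" for f i
  proof -
    have "(\<ominus>\<^bsub>product_ring I R\<^esub> f) i \<oplus>\<^bsub>R i\<^esub> f i = \<zero>\<^bsub>R i\<^esub>"
      using P.l_neg[OF f] add[OF i, of "\<ominus>\<^bsub>product_ring I R\<^esub> f" f] zero[OF i] by simp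
    moreover have "(\<ominus>\<^bsub>product_ring I R\<^esub> f) i \<in> carrier (R i)" "f i \<in> carrier (R i)"
      using f i by (auto intro!: carr)
    ultimately show ?thesis
      using abelian_group.minus_equality[OF ring.is_abelian_group[OF r[OF i]]] by metis
  qed
  have sub: "direct_sum I R \<subseteq> carrier (product_ring I R)"
    by (auto simp: direct_sum_def)
  show ?thesis
  proof (rule idealI)
    show "ring (product_ring I R)"
      by (rule P.ring_axioms)
    show "subgroup (direct_sum I R) (add_monoid (product_ring I R))"
    proof (rule group.subgroupI[OF P.a_group])
      have "\<zero>\<^bsub>product_ring I R\<^esub> \<in> direct_sum I R"
        by (simp add: direct_sum_def zero cong: conj_cong)
      then show "direct_sum I R \<noteq> {}" by blast
    next
      fix f assume f: "f \<in> direct_sum I R"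
      then have fc: "f \<in> carrier (product_ring I R)" using sub by blast
      have "?S (\<ominus>\<^bsub>product_ring I R\<^esub> f) \<subseteq> ?S f"
        using neg[OF fc] by auto
      then have "\<ominus>\<^bsub>product_ring I R\<^esub> f \<in> direct_sum I R"
        using f fc by (auto simp: direct_sum_def intro: finite_subset)
      then show "inv\<^bsub>add_monoid (product_ring I R)\<^esub> f \<in> direct_sum I R"
        by (simp add: a_inv_def)
    next
      fix f g assume fg: "f \<in> direct_sum I R" "g \<in> direct_sum I R"
      have "?S (f \<oplus>\<^bsub>product_ring I R\<^esub> g) \<subseteq> ?S f \<union> ?S g"
        using add by auto
      moreover have "finite (?S f \<union> ?S g)" using fg by (simp add: direct_sum_def)
      ultimately have "finite (?S (f \<oplus>\<^bsub>product_ring I R\<^esub> g))"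
        by (rule finite_subset)
      then show "f \<otimes>\<^bsub>add_monoid (product_ring I R)\<^esub> g \<in> direct_sum I R"
        using fg by (simp add: direct_sum_def)
    qed (use sub in simp)
  next
    fix f x assume f: "f \<in> direct_sum I R" and x: "x \<in> carrier (product_ring I R)"
    then have fc: "f \<in> carrier (product_ring I R)" using sub by blast
    have "?S (x \<otimes>\<^bsub>product_ring I R\<^esub> f) \<subseteq> ?S f"
      using carr[OF x] by (auto simp: mult)
    then show "x \<otimes>\<^bsub>product_ring I R\<^esub> f \<in> direct_sum I R"
      using f fc x by (auto simp: direct_sum_def intro: finite_subset)
    then show "f \<otimes>\<^bsub>product_ring I R\<^esub> x \<in> direct_sum I R"
      using P.m_comm[OF fc x] by simp
  qed
qed

subsection \<open>The ring \<open>\<A>\<close>\<close>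

definition primes :: "nat set" where
  "primes = {p. prime p}"

definition prime_prod :: "(nat \<Rightarrow> int) ring" where
  "prime_prod = product_ring primes (\<lambda>p. residue_ring (int p))"

definition prime_sum :: "(nat \<Rightarrow> int) set" where
  "prime_sum = direct_sum primes (\<lambda>p. residue_ring (int p))"

definition ring_A :: "(nat \<Rightarrow> int) set ring" where
  "ring_A = prime_prod Quot prime_sum"

lemma cring_residue_ring_prime: "p \<in> primes \<Longrightarrow> cring (residue_ring (int p))"
  by (rule residues.cring) (simp add: residues_def primes_def prime_gt_Suc_0_nat)

lemma ideal_prime_sum: "ideal prime_sum prime_prod"
  unfolding prime_sum_def prime_prod_def
  by (rule ideal_direct_sum) (rule cring_residue_ring_prime)

lemma cring_ring_A: "cring ring_A"
  unfolding ring_A_def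
  by (rule ideal.quotient_is_cring[OF ideal_prime_sum])
    (simp add: prime_prod_def cring_product_ring cring_residue_ring_prime)

text \<open>
  Reduction of a rational number modulo \<open>p\<close>; meaningful only if \<open>p\<close> does not divide the
  denominator, which always holds for the sums \<open>M\<^sub>p\<close> below.
\<close>
definition rat_mod :: "nat \<Rightarrow> rat \<Rightarrow> int" where
  "rat_mod p x =
    (fst (quotient_of x) * modular_inverse (int p) (snd (quotient_of x))) mod int p"

definition class_A :: "(nat \<Rightarrow> rat) \<Rightarrow> (nat \<Rightarrow> int) set" where
  "class_A x = prime_sum +>\<^bsub>prime_prod\<^esub> (\<lambda>p\<in>primes. rat_mod p (x p))"

lemma class_A_carrier: "class_A x \<in> carrier ring_A"
proof -
  have "(\<lambda>p\<in>primes. rat_mod p (x p)) \<in> carrier prime_prod"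
    by (auto simp: prime_prod_def product_ring_def residue_ring_def primes_def rat_mod_def
        prime_gt_0_nat)
  then show ?thesis
    by (auto simp: class_A_def ring_A_def FactRing_def A_RCOSETS_def' a_r_coset_def')
qed

subsection \<open>Finite multiple mixed values\<close>

text \<open>
  The list \<open>ms\<close> is the summation index \<open>0 < m\<^sub>1 < \<dots> < m\<^sub>r < N\<close>; the lists of exponents \<open>ks\<close>
  and of signs \<open>es\<close> are meant to have the same length.
\<close>
definition mixed_sum :: "nat \<Rightarrow> nat list \<Rightarrow> int list \<Rightarrow> rat" where
  "mixed_sum N ks es =
    (\<Sum>ms | length ms = length ks \<and> sorted_wrt (<) ms \<and> set ms \<subseteq> {0<..<N}.
      \<Prod>i<length ks. (1 + of_int (es ! i) * (-1) ^ (ms ! i)) / of_nat (ms ! i) ^ (ks ! i))"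

lemma finite_mixed_sum_index:
  "finite {ms. length ms = r \<and> sorted_wrt (<) ms \<and> set ms \<subseteq> {0<..<N::nat}}"
  by (rule finite_subset[OF _ finite_lists_length_eq[of "{0<..<N}" r]]) auto

definition M_A :: "nat list \<Rightarrow> int list \<Rightarrow> (nat \<Rightarrow> int) set" where
  "M_A ks es = class_A (\<lambda>p. mixed_sum p ks es)"

definition E_A :: "nat list \<Rightarrow> (nat \<Rightarrow> int) set" where
  "E_A ks = M_A ks (replicate (length ks) 1)"

definition t_A :: "nat list \<Rightarrow> (nat \<Rightarrow> int) set" where
  "t_A ks = M_A ks (replicate (length ks) (-1))"

end

(*
  Write n = (p - 1)/2. An even index m = 2j has weight 1/j, and an odd index m = p - 2i has
  weight congruent to -1/i modulo p; in particular reflecting all indices gives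
  t = (-1)^(a+2) E. With u = a - m + 1 even indices below s = m + 1 odd ones, the ordering
  condition at the boundary becomes max j + max i <= n, so the mixed value is congruent to (-1)^s
  times the sum of the coefficients of X^0, ..., X^n in (L^u / u!) * (L^s / s!), where
  L = - ln (1 - X) and L^u / u! collects the products 1/(j_1 ... j_u) according to the maximal j.
  This product is binom(u + s, s) L^(u+s) / (u + s)!, whose
  coefficient sum is binom(u + s, s) times E.
*)
theory Submission
  imports Defs "HOL-Computational_Algebra.Formal_Power_Series"
begin

subsection \<open>Nested sums\<close>

text \<open>The lower bound \<open>l\<close> is a parameter so that fixing the smallest index leaves
  a sum of the same shape. Arbitrary functions as factors make room for reflected weights.\<close>

primrec nested_sum :: "nat \<Rightarrow> nat \<Rightarrow> (nat \<Rightarrow> 'a::comm_ring_1) list \<Rightarrow> 'a" where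
  "nested_sum l N [] = 1"
| "nested_sum l N (f # fs) = (\<Sum>k\<in>{l<..<N}. f k * nested_sum k N fs)"

lemma finite_increasing_lists:
  "finite {ms. length ms = r \<and> sorted_wrt (<) ms \<and> set ms \<subseteq> {l<..<N::nat}}"
  by (rule finite_subset[OF _ finite_lists_length_eq[of "{l<..<N}" r]]) auto

text \<open>An increasing list in \<open>{l<..<N}\<close> is a head \<open>k\<close> followed by an
  increasing list in \<open>{k<..<N}\<close>.\<close>

lemma nested_sum_conv_sum_lists:
  "nested_sum l N fs =
     (\<Sum>ms | length ms = length fs \<and> sorted_wrt (<) ms \<and> set ms \<subseteq> {l<..<N}.
        \<Prod>i<length fs. (fs ! i) (ms ! i))"
proof (induction fs arbitrary: l)
  case Nil
  have "{ms :: nat list. length ms = 0 \<and> sorted_wrt (<) ms \<and> set ms \<subseteq> {l<..<N}} = {[]}"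
    by auto
  then show ?case by simp
next
  case (Cons f fs)
  let ?S = "\<lambda>r l. {ms. length ms = r \<and> sorted_wrt (<) ms \<and> set ms \<subseteq> {l<..<N}}"
  let ?cons = "\<lambda>(k, ms). k # ms"
  have S: "?S (length (f # fs)) l = ?cons ` (SIGMA k:{l<..<N}. ?S (length fs) k)"
  proof (intro equalityI subsetI)
    fix xs assume xs: "xs \<in> ?S (length (f # fs)) l"
    then obtain k ms where "xs = k # ms" by (cases xs) auto
    with xs show "xs \<in> ?cons ` (SIGMA k:{l<..<N}. ?S (length fs) k)"
      by (auto simp: image_iff)
  qed fastforce
  have inj: "inj_on ?cons (SIGMA k:{l<..<N}. ?S (length fs) k)"
    by (auto simp: inj_on_def)
  have "(\<Sum>ms\<in>?S (length (f # fs)) l. \<Prod>i<length (f # fs). ((f # fs) ! i) (ms ! i)) =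
        (\<Sum>(k, ms)\<in>(SIGMA k:{l<..<N}. ?S (length fs) k). f k * (\<Prod>i<length fs. (fs ! i) (ms ! i)))"
    unfolding S sum.reindex[OF inj]
    by (intro sum.cong) (auto simp del: prod.lessThan_Suc simp: prod.lessThan_Suc_shift)
  also have "\<dots> = (\<Sum>k\<in>{l<..<N}. \<Sum>ms\<in>?S (length fs) k. f k * (\<Prod>i<length fs. (fs ! i) (ms ! i)))"
    by (rule sum.Sigma[symmetric]) (auto intro: finite_increasing_lists)
  also have "\<dots> = nested_sum l N (f # fs)"
    by (simp add: Cons.IH sum_distrib_left)
  finally show ?case by simp
qed

text \<open>Once the index \<open>k\<close> belonging to \<open>f\<close> is fixed, the indices
  below and above it range independently.\<close>

lemma nested_sum_append_Cons:
  "nested_sum l N (fs @ f # gs) =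
     (\<Sum>k\<in>{l<..<N}. nested_sum l k fs * f k * nested_sum k N gs)"
proof (induction fs arbitrary: l)
  case (Cons h fs)
  have "nested_sum l N ((h # fs) @ f # gs) =
        (\<Sum>j\<in>{l<..<N}. \<Sum>k\<in>{j<..<N}. h j * (nested_sum j k fs * f k * nested_sum k N gs))"
    by (simp add: Cons.IH sum_distrib_left)
  \<comment> \<open>Both orders of summation run over the pairs l < j < k < N.\<close>
  also have "\<dots> = (\<Sum>k\<in>{l<..<N}. \<Sum>j\<in>{l<..<k}. h j * (nested_sum j k fs * f k * nested_sum k N gs))"
    by (subst (1 2) sum.Sigma) (auto intro!: sum.reindex_bij_witness[of _ prod.swap prod.swap])
  also have "\<dots> = (\<Sum>k\<in>{l<..<N}. nested_sum l k (h # fs) * f k * nested_sum k N gs)"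
    by (simp add: sum_distrib_left sum_distrib_right mult_ac)
  finally show ?case .
qed simp

lemma nested_sum_snoc:
  "nested_sum l N (fs @ [f]) = (\<Sum>k\<in>{l<..<N}. nested_sum l k fs * f k)"
  by (simp add: nested_sum_append_Cons)

text \<open>Substituting \<open>c - k\<close> for each index \<open>k\<close> reverses their order,
  hence \<open>rev\<close>; \<open>N \<le> c\<close> makes truncated subtraction an involution on
  the range.\<close>

lemma nested_sum_reflect:
  assumes "N \<le> c"
  shows "nested_sum (c - N) (c - l) (map (\<lambda>f k. f (c - k)) (rev fs)) = nested_sum l N fs"
proof (induction fs arbitrary: l)
  case (Cons f fs)
  have "nested_sum (c - N) (c - l) (map (\<lambda>f k. f (c - k)) (rev (f # fs))) =
     (\<Sum>k\<in>{c - N<..<c - l}. nested_sum (c - N) k (map (\<lambda>f k. f (c - k)) (rev fs)) * f (c - k))"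
    by (simp add: nested_sum_snoc)
  also have "\<dots> = (\<Sum>k\<in>{l<..<N}.
      nested_sum (c - N) (c - k) (map (\<lambda>f k. f (c - k)) (rev fs)) * f k)"
    using assms by (intro sum.reindex_bij_witness[of _ "\<lambda>k. c - k" "\<lambda>k. c - k"]) auto
  also have "\<dots> = nested_sum l N (f # fs)"
    by (simp add: Cons.IH mult.commute)
  finally show ?case .
qed simp

lemma nested_sum_replicate_uminus:
  "nested_sum l N (replicate s (\<lambda>m. - f m)) = (-1) ^ s * nested_sum l N (replicate s f)"
  by (induction s arbitrary: l) (simp_all add: sum_distrib_left mult_ac sum_negf)

text \<open>The factor of one index with exponent 1. At positive m it is 2/m for even m and 0 for
  odd m if \<open>e = 1\<close>, and the other way round if \<open>e = -1\<close>.\<close>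

definition weight :: "int \<Rightarrow> nat \<Rightarrow> rat" where
  "weight e m = (1 + of_int e * (-1) ^ m) / of_nat m"

lemma mixed_sum_eq_nested_sum:
  "mixed_sum N (replicate (length es) 1) es = nested_sum 0 N (map weight es)"
  by (simp add: mixed_sum_def nested_sum_conv_sum_lists weight_def)

subsection \<open>Powers of the logarithm\<close>

text \<open>With \<open>L = - ln (1 - X)\<close> these are \<open>L ^ u / u!\<close> and \<open>L ^ u / (u! * (1 - X))\<close>.\<close>

definition log_pow :: "nat \<Rightarrow> rat fps" where
  "log_pow u = fps_const (1 / fact u) * Abs_fps (\<lambda>n. 1 / of_nat n) ^ u"

definition harm_fps :: "nat \<Rightarrow> rat fps" where
  "harm_fps u = log_pow u * Abs_fps (\<lambda>_. 1)"

lemma harm_fps_nth: "fps_nth (harm_fps u) n = (\<Sum>j\<le>n. fps_nth (log_pow u) j)"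
  by (simp add: harm_fps_def fps_mult_nth atLeast0AtMost)

text \<open>The coefficient \<open>1 / of_nat 0\<close> is 0, so L and its positive powers have no
  constant term.\<close>

lemma log_pow_Suc_nth_0: "fps_nth (log_pow (Suc u)) 0 = 0"
  by (simp add: log_pow_def)

text \<open>Since L' = 1/(1 - X), the derivative of L^(u+1)/(u+1)! is L^u/(u! (1 - X)); compare
  coefficients of X^n.\<close>

lemma log_pow_Suc_nth_Suc:
  "fps_nth (log_pow (Suc u)) (Suc n) = fps_nth (harm_fps u) n / of_nat (Suc n)"
proof -
  let ?L = "Abs_fps (\<lambda>n. 1 / of_nat n) :: rat fps"
  have dL: "fps_deriv ?L = Abs_fps (\<lambda>_. 1)"
    by (rule fps_ext) (simp del: of_nat_Suc)
  have c: "fps_const (1 / fact (Suc u)) * of_nat (Suc u) = (fps_const (1 / fact u) :: rat fps)"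
    unfolding fps_of_nat[symmetric] fps_const_mult
    by (simp add: field_simps del: of_nat_Suc)
  have "fps_deriv (log_pow (Suc u)) =
        (fps_const (1 / fact (Suc u)) * of_nat (Suc u)) * (fps_deriv ?L * ?L ^ u)"
    by (simp add: log_pow_def fps_deriv_power' mult_ac del: of_nat_Suc power_Suc fact_Suc)
  also have "\<dots> = harm_fps u"
    unfolding c dL by (simp add: harm_fps_def log_pow_def mult_ac)
  finally have "fps_nth (fps_deriv (log_pow (Suc u))) n = fps_nth (harm_fps u) n"
    by simp
  then show ?thesis by (simp add: field_simps del: of_nat_Suc)
qed

text \<open>Powers of L multiply, the factorials combine to the binomial coefficient, and 1/(1 - X)
  occurs once on each side.\<close>

lemma log_pow_mult_harm_fps:
  "log_pow u * harm_fps s = fps_const (of_nat ((u + s) choose s)) * harm_fps (u + s)"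
proof -
  have "1 / fact u * (1 / fact s) = of_nat ((u + s) choose s) * (1 / fact (u + s) :: rat)"
    by (simp add: binomial_fact)
  then have c: "fps_const (1 / fact u) * fps_const (1 / fact s) =
      fps_const (of_nat ((u + s) choose s)) * (fps_const (1 / fact (u + s)) :: rat fps)"
    by simp
  have "log_pow u * harm_fps s = (fps_const (1 / fact u) * fps_const (1 / fact s)) *
      (Abs_fps (\<lambda>n. 1 / of_nat n) ^ (u + s) * Abs_fps (\<lambda>_. 1))"
    by (simp only: log_pow_def harm_fps_def power_add mult_ac)
  also have "\<dots> = fps_const (of_nat ((u + s) choose s)) * harm_fps (u + s)"
    unfolding c by (simp only: log_pow_def harm_fps_def mult_ac)
  finally show ?thesis .
qed

section \<open>Nested sums over even indices as power series coefficients\<close>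

lemma sum_even_support:
  fixes N :: nat
  assumes "\<And>k. odd k \<Longrightarrow> h k = 0"
  shows "(\<Sum>k\<in>{0<..<N}. h k) = (\<Sum>j\<in>{0<..(N - 1) div 2}. h (2 * j))"
proof -
  have "(\<Sum>k\<in>{0<..<N}. h k) = (\<Sum>k\<in>{k\<in>{0<..<N}. even k}. h k)"
    by (rule sum.mono_neutral_right) (use assms in auto)
  \<comment> \<open>For positive j, 2j < N holds exactly when j \<le>
    \<open>(N - 1) div 2\<close>.\<close>
  also have "\<dots> = (\<Sum>j\<in>{0<..(N - 1) div 2}. h (2 * j))"
    by (rule sum.reindex_bij_witness[of _ "\<lambda>j. 2 * j" "\<lambda>k. k div 2"]) auto
  finally show ?thesis .
qed

lemma weight_1_odd: "odd k \<Longrightarrow> weight 1 k = 0"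
  by (simp add: weight_def)

lemma weight_1_double: "weight 1 (2 * j) = 1 / of_nat j"
  by (simp add: weight_def)

lemma log_pow_Suc_nth:
  "fps_nth (log_pow (Suc u)) j = fps_nth (harm_fps u) (j - 1) / of_nat j"
  \<comment> \<open>At \<open>j = 0\<close> the right-hand side is a division by zero, hence 0 like
    the left.\<close>
  by (cases j) (simp_all add: log_pow_Suc_nth_0 log_pow_Suc_nth_Suc del: of_nat_Suc)

text \<open>Peel off the largest index 2j: its factor 1/j is the one in the recursion for the
  coefficients of L^(u+1)/(u+1)!, and summing over j is multiplication by 1/(1 - X).\<close>

lemma nested_sum_weight_1:
  "nested_sum 0 N (replicate u (weight 1)) = fps_nth (harm_fps u) ((N - 1) div 2)"
proof (induction u arbitrary: N)
  case 0
  show ?case by (simp add: harm_fps_def log_pow_def)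
next
  case (Suc u)
  let ?n = "(N - 1) div 2"
  have "nested_sum 0 N (replicate (Suc u) (weight 1)) =
      (\<Sum>k\<in>{0<..<N}. fps_nth (harm_fps u) ((k - 1) div 2) * weight 1 k)"
    by (simp add: replicate_append_same[symmetric] nested_sum_snoc Suc.IH del: nested_sum.simps(2))
  also have "\<dots> = (\<Sum>j\<in>{0<..?n}. fps_nth (harm_fps u) ((2 * j - 1) div 2) * weight 1 (2 * j))"
    by (rule sum_even_support) (simp add: weight_1_odd)
  also have "\<dots> = (\<Sum>j\<in>{0<..?n}. fps_nth (log_pow (Suc u)) j)"
  proof (rule sum.cong)
    fix j assume "j \<in> {0<..?n}"
    \<comment> \<open>The remaining indices 2i lie strictly below 2j, so i stops at j - 1.\<close>
    then have "(2 * j - 1) div 2 = j - 1" by auto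
    then show "fps_nth (harm_fps u) ((2 * j - 1) div 2) * weight 1 (2 * j) =
      fps_nth (log_pow (Suc u)) j"
      by (simp add: weight_1_double log_pow_Suc_nth)
  qed simp
  also have "\<dots> = (\<Sum>j\<le>?n. fps_nth (log_pow (Suc u)) j)"
    by (rule sum.mono_neutral_left) (auto simp: log_pow_Suc_nth_0)
  finally show ?case by (simp add: harm_fps_nth)
qed

text \<open>The reflection of m to p - m carries k < m < p to the range 0 < m < p - k, where the sum
  over even indices is known.\<close>

lemma nested_sum_reflected_weight:
  assumes "k \<le> p"
  shows "nested_sum k p (replicate s (\<lambda>m. - weight 1 (p - m))) =
         (-1) ^ s * fps_nth (harm_fps s) ((p - k - 1) div 2)"
proof -
  have "nested_sum (p - (p - k)) (p - 0)
        (map (\<lambda>f m. f (p - m)) (rev (replicate s (\<lambda>m. - weight 1 m)))) =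
      nested_sum 0 (p - k) (replicate s (\<lambda>m. - weight 1 m))"
    by (rule nested_sum_reflect) simp
  then show ?thesis
    using assms by (simp add: nested_sum_replicate_uminus nested_sum_weight_1)
qed

text \<open>Cut at the largest index 2j of the first block, which exists because its length is
  \<open>Suc u\<close>. For fixed j the two blocks give a coefficient of \<open>log_pow\<close> and
  one of \<open>harm_fps\<close>, and summing over j is a Cauchy product. The identity is exact in
  the rationals; the congruence enters only when weights are replaced by reflected ones.\<close>

lemma nested_sum_weight_reflected_weight:
  assumes "odd p"
  shows "nested_sum 0 p (replicate (Suc u) (weight 1) @ replicate s (\<lambda>m. - weight 1 (p - m))) =
         (-1) ^ s * of_nat ((Suc u + s) choose s) *
           nested_sum 0 p (replicate (Suc u + s) (weight 1))"
proof -
  let ?g = "\<lambda>m. - weight 1 (p - m)"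
  define n where "n = (p - 1) div 2"
  from assms have p: "p = 2 * n + 1" by (auto simp: n_def elim!: oddE)
  have "replicate (Suc u) (weight 1) @ replicate s ?g =
        replicate u (weight 1) @ weight 1 # replicate s ?g"
    by (simp add: replicate_append_same[symmetric])
  then have "nested_sum 0 p (replicate (Suc u) (weight 1) @ replicate s ?g) =
      (\<Sum>k\<in>{0<..<p}. nested_sum 0 k (replicate u (weight 1)) * weight 1 k
         * nested_sum k p (replicate s ?g))"
    by (simp only: nested_sum_append_Cons)
  also have "\<dots> = (\<Sum>j\<in>{0<..n}. nested_sum 0 (2 * j) (replicate u (weight 1)) * weight 1 (2 * j)
         * nested_sum (2 * j) p (replicate s ?g))"
    unfolding n_def by (rule sum_even_support) (simp add: weight_1_odd)
  also have "\<dots> = (\<Sum>j\<in>{0<..n}. (-1) ^ s *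
      (fps_nth (log_pow (Suc u)) j * fps_nth (harm_fps s) (n - j)))"
  proof (rule sum.cong)
    fix j assume j: "j \<in> {0<..n}"
    \<comment> \<open>As p = 2n + 1, a reflected index 2i < p - 2j amounts to i \<le> n - j.\<close>
    then have "(2 * j - 1) div 2 = j - 1" "(p - 2 * j - 1) div 2 = n - j" "2 * j \<le> p"
      by (auto simp: p)
    then show "nested_sum 0 (2 * j) (replicate u (weight 1)) * weight 1 (2 * j)
         * nested_sum (2 * j) p (replicate s ?g) =
       (-1) ^ s * (fps_nth (log_pow (Suc u)) j * fps_nth (harm_fps s) (n - j))"
      by (simp add: nested_sum_weight_1 nested_sum_reflected_weight weight_1_double
          log_pow_Suc_nth)
  qed simp
  \<comment> \<open>The vanishing constant term of \<open>log_pow (Suc u)\<close> lets j = 0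
    complete the Cauchy product.\<close>
  also have "\<dots> = (\<Sum>j=0..n. (-1) ^ s *
      (fps_nth (log_pow (Suc u)) j * fps_nth (harm_fps s) (n - j)))"
    by (rule sum.mono_neutral_left) (auto simp: log_pow_Suc_nth_0)
  also have "\<dots> = (-1) ^ s * fps_nth (log_pow (Suc u) * harm_fps s) n"
    by (simp only: fps_mult_nth sum_distrib_left)
  also have "\<dots> = (-1) ^ s * of_nat ((Suc u + s) choose s) * fps_nth (harm_fps (Suc u + s)) n"
    by (simp add: log_pow_mult_harm_fps)
  finally show ?thesis by (simp only: nested_sum_weight_1 n_def)
qed

subsection \<open>Congruences between rational numbers\<close>

text \<open>A partial equivalence relation: its domain consists of the \<open>p\<close>-integral rationals.\<close>

definition rat_cong :: "nat \<Rightarrow> rat \<Rightarrow> rat \<Rightarrow> bool" where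
  "rat_cong p x y \<longleftrightarrow> (\<exists>a c b. \<not> int p dvd b \<and> [a = c] (mod int p) \<and>
     x = of_int a / of_int b \<and> y = of_int c / of_int b)"

lemma rat_cong_add:
  assumes "prime p" "rat_cong p x y" "rat_cong p x' y'"
  shows "rat_cong p (x + x') (y + y')"
proof -
  from assms(2) obtain a c b where b: "\<not> int p dvd b" and ac: "[a = c] (mod int p)"
    and x: "x = of_int a / of_int b" and y: "y = of_int c / of_int b"
    unfolding rat_cong_def by blast
  from assms(3) obtain a' c' b' where b': "\<not> int p dvd b'" and ac': "[a' = c'] (mod int p)"
    and x': "x' = of_int a' / of_int b'" and y': "y' = of_int c' / of_int b'"
    unfolding rat_cong_def by blast
  have "b \<noteq> 0" "b' \<noteq> 0" using b b' by auto
  then have "x + x' = of_int (a * b' + a' * b) / of_int (b * b')"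
    "y + y' = of_int (c * b' + c' * b) / of_int (b * b')"
    by (simp_all add: x x' y y' field_simps)
  moreover have "[a * b' + a' * b = c * b' + c' * b] (mod int p)"
    using ac ac' by (intro cong_add cong_mult cong_refl)
  moreover have "\<not> int p dvd b * b'"
    using assms(1) b b' by (simp add: prime_dvd_mult_iff)
  ultimately show ?thesis unfolding rat_cong_def by blast
qed

lemma rat_cong_mult:
  assumes "prime p" "rat_cong p x y" "rat_cong p x' y'"
  shows "rat_cong p (x * x') (y * y')"
proof -
  from assms(2) obtain a c b where b: "\<not> int p dvd b" and ac: "[a = c] (mod int p)"
    and x: "x = of_int a / of_int b" and y: "y = of_int c / of_int b"
    unfolding rat_cong_def by blast
  from assms(3) obtain a' c' b' where b': "\<not> int p dvd b'" and ac': "[a' = c'] (mod int p)"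
    and x': "x' = of_int a' / of_int b'" and y': "y' = of_int c' / of_int b'"
    unfolding rat_cong_def by blast
  have "x * x' = of_int (a * a') / of_int (b * b')"
    "y * y' = of_int (c * c') / of_int (b * b')"
    by (simp_all add: x x' y y')
  moreover have "[a * a' = c * c'] (mod int p)"
    using ac ac' by (rule cong_mult)
  moreover have "\<not> int p dvd b * b'"
    using assms(1) b b' by (simp add: prime_dvd_mult_iff)
  ultimately show ?thesis unfolding rat_cong_def by blast
qed

lemma rat_cong_of_int:
  assumes "prime p"
  shows "rat_cong p (of_int c) (of_int c)"
proof -
  have "\<not> int p dvd 1" using assms by (simp add: prime_nat_iff)
  then show ?thesis unfolding rat_cong_def
    by (intro exI[of _ c] exI[of _ 1]) auto
qed

lemma rat_cong_sum:
  assumes "prime p" "\<And>i. i \<in> A \<Longrightarrow> rat_cong p (f i) (g i)"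
  shows "rat_cong p (sum f A) (sum g A)"
  using assms(2)
proof (induction A rule: infinite_finite_induct)
  case (insert i A)
  then show ?case by (simp add: rat_cong_add[OF assms(1)])
qed (use rat_cong_of_int[OF assms(1), of 0] in simp_all)

lemma rat_cong_nested_sum:
  assumes p: "prime p"
    and "list_all2 (\<lambda>f g. \<forall>k\<in>{l<..<N}. rat_cong p (f k) (g k)) fs gs"
  shows "rat_cong p (nested_sum l N fs) (nested_sum l N gs)"
  using assms(2)
proof (induction fs arbitrary: l gs)
  case Nil
  then show ?case using rat_cong_of_int[OF p, of 1] by simp
next
  case (Cons f fs)
  then obtain g gs' where gs: "gs = g # gs'"
    and fg: "\<And>k. k \<in> {l<..<N} \<Longrightarrow> rat_cong p (f k) (g k)"
    and rest: "list_all2 (\<lambda>f g. \<forall>k\<in>{l<..<N}. rat_cong p (f k) (g k)) fs gs'"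
    by (auto simp: list_all2_Cons1)
  \<comment> \<open>The indices after j lie in a smaller interval, so the pointwise hypothesis
    persists.\<close>
  have "list_all2 (\<lambda>f g. \<forall>k\<in>{j<..<N}. rat_cong p (f k) (g k)) fs gs'" if "j \<in> {l<..<N}" for j
    using rest by (rule list_all2_mono) (use that in auto)
  then have "rat_cong p (nested_sum j N fs) (nested_sum j N gs')" if "j \<in> {l<..<N}" for j
    by (rule Cons.IH) (rule that)
  then show ?case
    unfolding gs by (auto intro!: rat_cong_sum rat_cong_mult p fg)
qed

text \<open>Congruence of a number to itself expresses p-integrality; here the denominator m is
  prime to p.\<close>

lemma rat_cong_weight:
  assumes "prime p" "0 < m" "m < p"
  shows "rat_cong p (weight e m) (weight e m)"
proof -
  have "\<not> int p dvd int m" using assms by (auto dest: zdvd_imp_le)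
  moreover have "weight e m = of_int (1 + e * (-1) ^ m) / of_int (int m)"
    by (simp add: weight_def)
  ultimately show ?thesis unfolding rat_cong_def by (metis cong_refl)
qed

text \<open>Modulo p, m equals -(p - m), and for odd p exactly one of m and p - m is even, so the
  numerators coincide.\<close>

lemma rat_cong_weight_reflect:
  assumes "prime p" "odd p" "0 < m" "m < p"
  shows "rat_cong p (weight (-1) m) (- weight 1 (p - m))"
proof -
  define d :: int where "d = 1 - (-1) ^ m"
  have "(-1) ^ (p - m) = - ((-1) ^ m :: int)"
    using assms by (cases "even m") auto
  then have d': "d = 1 + (-1) ^ (p - m)" by (simp add: d_def)
  have m: "\<not> int p dvd int m" "\<not> int p dvd int (p - m)"
    using assms by (auto dest!: zdvd_imp_le)
  have "weight (-1) m = of_int d / of_nat m" by (simp add: weight_def d_def)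
  also have "\<dots> = of_int (d * int (p - m)) / of_int (int m * int (p - m))"
    using assms(3,4) by (simp add: field_simps)
  finally have 1: "weight (-1) m = \<dots>" .
  have "- weight 1 (p - m) = - of_int d / of_nat (p - m)" by (simp add: weight_def d' minus_divide_left)
  also have "\<dots> = of_int (- d * int m) / of_int (int m * int (p - m))"
    using assms(3,4) by (simp add: field_simps)
  finally have 2: "- weight 1 (p - m) = \<dots>" .
  \<comment> \<open>Over the common denominator m (p - m), the numerators differ by a multiple of
    p.\<close>
  have "d * int (p - m) - (- d * int m) = d * int p"
    using assms(3,4) by (simp add: of_nat_diff algebra_simps)
  then have "[d * int (p - m) = - d * int m] (mod int p)"
    by (metis cong_iff_dvd_diff dvd_triv_right)
  moreover have "\<not> int p dvd int m * int (p - m)"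
    using m assms(1) by (simp add: prime_dvd_mult_iff)
  ultimately show ?thesis using 1 2 unfolding rat_cong_def by blast
qed

section \<open>Residues of rational numbers modulo a prime\<close>

lemma coprime_if_not_prime_dvd:
  assumes "prime p" "\<not> int p dvd b"
  shows "coprime b (int p)"
  using prime_imp_coprime[of "int p" b] assms by (simp add: coprime_commute)

text \<open>\<open>rat_mod\<close> is defined by the reduced fraction q/d. As d divides b, it is
  invertible modulo p, so any fraction with denominator prime to p yields the same residue.\<close>

lemma rat_mod_mult_denom:
  assumes "prime p" "\<not> int p dvd b"
  shows "[rat_mod p (of_int a / of_int b) * b = a] (mod int p)"
proof -
  let ?x = "of_int a / of_int b :: rat"
  obtain q d where qd: "quotient_of ?x = (q, d)" by force
  have b0: "b \<noteq> 0" using assms(2) by auto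
  have d0: "d > 0" using qd by (rule quotient_of_denom_pos)
  have "?x = of_int q / of_int d" using qd by (rule quotient_of_div)
  then have "of_int (a * d) = (of_int (q * b) :: rat)"
    using b0 d0 by (simp add: field_simps)
  then have eq: "a * d = q * b" by (simp only: of_int_eq_iff)
  have "coprime d q" using quotient_of_coprime[OF qd] by (simp add: coprime_commute)
  moreover have "d dvd q * b" using eq by (metis dvd_triv_right)
  ultimately have "d dvd b" by (simp add: coprime_dvd_mult_right_iff)
  then have "\<not> int p dvd d" using assms(2) dvd_trans by blast
  then have cop: "coprime d (int p)"
    using assms(1) by (intro coprime_if_not_prime_dvd)
  \<comment> \<open>The extra factor d meets its modular inverse and is cancelled at the
    end.\<close>
  have "[rat_mod p ?x * b * d = q * modular_inverse (int p) d * b * d] (mod int p)"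
    by (intro cong_mult cong_refl) (simp add: rat_mod_def qd cong_def)
  also have "q * modular_inverse (int p) d * b * d = q * b * (d * modular_inverse (int p) d)"
    by (simp add: mult_ac)
  also have "[\<dots> = q * b * 1] (mod int p)"
    using cop by (intro cong_mult cong_refl cong_modular_inverse1)
  finally have "[rat_mod p ?x * b * d = a * d] (mod int p)" by (simp add: eq)
  then show ?thesis using cop by (simp add: cong_mult_rcancel)
qed

lemma rat_mod_eqI:
  assumes "prime p" "\<not> int p dvd b" "[r * b = a] (mod int p)" "0 \<le> r" "r < int p"
  shows "rat_mod p (of_int a / of_int b) = r"
proof -
  have "[rat_mod p (of_int a / of_int b) * b = r * b] (mod int p)"
    using rat_mod_mult_denom[OF assms(1,2)] assms(3) by (metis cong_sym cong_trans)
  then have "[rat_mod p (of_int a / of_int b) = r] (mod int p)"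
    using cong_mult_rcancel[OF coprime_if_not_prime_dvd[OF assms(1,2)]] by blast
  then show ?thesis
    using assms(1,4,5) by (simp add: cong_def rat_mod_def)
qed

lemma rat_mod_bounds: "prime p \<Longrightarrow> 0 \<le> rat_mod p x \<and> rat_mod p x < int p"
  by (simp add: rat_mod_def prime_gt_0_nat)

lemma rat_mod_cong:
  assumes "prime p" "rat_cong p x y"
  shows "rat_mod p x = rat_mod p y"
proof -
  from assms(2) obtain a c b where b: "\<not> int p dvd b" and ac: "[a = c] (mod int p)"
    and x: "x = of_int a / of_int b" and y: "y = of_int c / of_int b"
    unfolding rat_cong_def by blast
  have "[rat_mod p y * b = a] (mod int p)"
    using rat_mod_mult_denom[OF assms(1) b, of c] ac
    unfolding y by (metis cong_sym cong_trans)
  then show ?thesis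
    unfolding x using assms(1) b rat_mod_bounds[OF assms(1)] by (intro rat_mod_eqI) auto
qed

text \<open>For p-integral x and y, multiplying by both denominators reduces the claim to a
  congruence of integers.\<close>

lemma rat_mod_add:
  assumes "prime p" "rat_cong p x x" "rat_cong p y y"
  shows "rat_mod p (x + y) = (rat_mod p x + rat_mod p y) mod int p"
proof -
  from assms(2) obtain a b where b: "\<not> int p dvd b" and x: "x = of_int a / of_int b"
    unfolding rat_cong_def by blast
  from assms(3) obtain a' b' where b': "\<not> int p dvd b'" and y: "y = of_int a' / of_int b'"
    unfolding rat_cong_def by blast
  have "b \<noteq> 0" "b' \<noteq> 0" using b b' by auto
  then have xy: "x + y = of_int (a * b' + a' * b) / of_int (b * b')"
    by (simp add: x y field_simps)
  have bb: "\<not> int p dvd b * b'"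
    using assms(1) b b' by (simp add: prime_dvd_mult_iff)
  have "[(rat_mod p x + rat_mod p y) mod int p * (b * b') =
      (rat_mod p x + rat_mod p y) * (b * b')] (mod int p)"
    by (intro cong_mult cong_refl) simp
  also have "(rat_mod p x + rat_mod p y) * (b * b') =
      (rat_mod p x * b) * b' + (rat_mod p y * b') * b"
    by (simp add: algebra_simps)
  also have "[\<dots> = a * b' + a' * b] (mod int p)"
    unfolding x y by (intro cong_add cong_mult cong_refl rat_mod_mult_denom assms(1) b b')
  finally show ?thesis
    unfolding xy using assms(1) bb by (intro rat_mod_eqI) (auto simp: prime_gt_0_nat)
qed

subsection \<open>Arithmetic in \<open>\<A>\<close>\<close>

lemma rat_mod_family_carrier: "(\<lambda>p\<in>primes. rat_mod p (x p)) \<in> carrier prime_prod"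
  by (auto simp: prime_prod_def product_ring_def residue_ring_def primes_def rat_mod_def
      prime_gt_0_nat)

lemma cring_prime_prod: "cring prime_prod"
  by (simp add: prime_prod_def cring_product_ring cring_residue_ring_prime)

text \<open>The difference of the two families has finite support, so it lies in the direct
  sum.\<close>

lemma coset_eq_if_cofinitely_eq:
  assumes f: "f \<in> carrier prime_prod" and g: "g \<in> carrier prime_prod"
    and fin: "finite {p \<in> primes. f p \<noteq> g p}"
  shows "prime_sum +>\<^bsub>prime_prod\<^esub> f = prime_sum +>\<^bsub>prime_prod\<^esub> g"
proof -
  interpret P: cring prime_prod by (rule cring_prime_prod)
  interpret I: ideal prime_sum prime_prod by (rule ideal_prime_sum)
  define h where "h = f \<ominus>\<^bsub>prime_prod\<^esub> g"
  have h: "h \<in> carrier prime_prod" using f g by (simp add: h_def)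
  have hg: "h \<oplus>\<^bsub>prime_prod\<^esub> g = f"
    using f g by (simp add: h_def a_minus_def P.a_assoc P.l_neg)
  have "h p = \<zero>\<^bsub>residue_ring (int p)\<^esub>" if p: "p \<in> primes" and eq: "f p = g p" for p
  proof -
    interpret R: cring "residue_ring (int p)" by (rule cring_residue_ring_prime) fact
    have hp: "h p \<in> carrier (residue_ring (int p))" and gp: "g p \<in> carrier (residue_ring (int p))"
      using h g p by (auto simp: prime_prod_def product_ring_def)
    \<comment> \<open>The component \<open>h p\<close> is found by cancelling \<open>g p\<close> in
      \<open>h + g = f\<close>, without computing a subtraction in the residue ring.\<close>
    have "h p \<oplus>\<^bsub>residue_ring (int p)\<^esub> g p = (h \<oplus>\<^bsub>prime_prod\<^esub> g) p"
      using p by (simp add: prime_prod_def product_ring_def)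
    also have "\<dots> = g p" using eq by (simp add: hg)
    finally show ?thesis using hp gp by (metis R.add.r_cancel_one)
  qed
  then have "{p \<in> primes. h p \<noteq> \<zero>\<^bsub>residue_ring (int p)\<^esub>} \<subseteq> {p \<in> primes. f p \<noteq> g p}"
    by auto
  then have "h \<in> prime_sum"
    using h fin by (auto simp: prime_sum_def direct_sum_def prime_prod_def intro: finite_subset)
  then show ?thesis
    using P.quotient_eq_iff_same_a_r_cos[OF ideal_prime_sum f g] by (simp add: h_def)
qed

lemma class_A_cong:
  assumes "finite {p. prime p \<and> \<not> rat_cong p (x p) (y p)}"
  shows "class_A x = class_A y"
  unfolding class_A_def
  by (intro coset_eq_if_cofinitely_eq rat_mod_family_carrier finite_subset[OF _ assms])
    (auto simp: primes_def dest: rat_mod_cong)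

lemma class_A_add:
  assumes "finite {p. prime p \<and> \<not> rat_cong p (x p) (x p)}"
    and "finite {p. prime p \<and> \<not> rat_cong p (y p) (y p)}"
  shows "class_A (\<lambda>p. x p + y p) = class_A x \<oplus>\<^bsub>ring_A\<^esub> class_A y"
proof -
  interpret P: cring prime_prod by (rule cring_prime_prod)
  interpret I: ideal prime_sum prime_prod by (rule ideal_prime_sum)
  let ?r = "\<lambda>x. \<lambda>p\<in>primes. rat_mod p (x p)"
  have "class_A x \<oplus>\<^bsub>ring_A\<^esub> class_A y = prime_sum +>\<^bsub>prime_prod\<^esub> (?r x \<oplus>\<^bsub>prime_prod\<^esub> ?r y)"
    unfolding class_A_def ring_A_def FactRing_def
    by (simp add: I.a_rcos_sum rat_mod_family_carrier)
  also have "\<dots> = class_A (\<lambda>p. x p + y p)"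
    unfolding class_A_def
  proof (rule coset_eq_if_cofinitely_eq)
    have "rat_mod p (x p + y p) = (?r x \<oplus>\<^bsub>prime_prod\<^esub> ?r y) p"
      if "prime p" "rat_cong p (x p) (x p)" "rat_cong p (y p) (y p)" for p
      using that
      by (simp add: primes_def prime_prod_def product_ring_def residue_ring_def rat_mod_add)
    then show "finite {p \<in> primes. (?r x \<oplus>\<^bsub>prime_prod\<^esub> ?r y) p \<noteq> ?r (\<lambda>p. x p + y p) p}"
      by (intro finite_subset[OF _ finite_UnI[OF assms]]) (auto simp: primes_def)
  qed (simp_all add: rat_mod_family_carrier)
  finally show ?thesis by simp
qed

text \<open>The integer multiple in \<open>ring_A\<close> is an iterated sum, so additivity of
  \<open>class_A\<close> gives the claim by induction on c in both directions from 0.\<close>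

lemma class_A_int_mult:
  assumes x: "finite {p. prime p \<and> \<not> rat_cong p (x p) (x p)}"
  shows "class_A (\<lambda>p. of_int c * x p) = [c] \<cdot>\<^bsub>ring_A\<^esub> class_A x"
proof -
  interpret A: cring ring_A by (rule cring_ring_A)
  let ?X = "class_A x"
  have X: "?X \<in> carrier ring_A" by (rule class_A_carrier)
  have step: "class_A (\<lambda>p. of_int (c + 1) * x p) = class_A (\<lambda>p. of_int c * x p) \<oplus>\<^bsub>ring_A\<^esub> ?X" for c
  proof -
    have "finite {p. prime p \<and> \<not> rat_cong p (of_int c * x p) (of_int c * x p)}"
      by (rule finite_subset[OF _ x]) (auto intro: rat_cong_mult rat_cong_of_int)
    from class_A_add[OF this x] show ?thesis by (simp add: algebra_simps)
  qed
  have step': "[(c + 1)] \<cdot>\<^bsub>ring_A\<^esub> ?X = [c] \<cdot>\<^bsub>ring_A\<^esub> ?X \<oplus>\<^bsub>ring_A\<^esub> ?X" for c :: int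
    using A.add.int_pow_mult[OF X, of c 1] X by simp
  have carr: "[c] \<cdot>\<^bsub>ring_A\<^esub> ?X \<in> carrier ring_A" for c :: int
    using X by simp
  have zero: "class_A (\<lambda>p. of_int 0 * x p) = [(0 :: int)] \<cdot>\<^bsub>ring_A\<^esub> ?X"
  proof -
    \<comment> \<open>Adding \<open>?X\<close> to the class of 0 gives \<open>?X\<close> again, so
      that class is the zero of the ring.\<close>
    have "class_A (\<lambda>p. of_int 0 * x p) \<oplus>\<^bsub>ring_A\<^esub> ?X = class_A (\<lambda>p. of_int (0 + 1) * x p)"
      by (rule step[symmetric])
    also have "\<dots> = ?X" by simp
    finally have "class_A (\<lambda>p. of_int 0 * x p) = \<zero>\<^bsub>ring_A\<^esub>"
      using A.add.r_cancel_one[OF X class_A_carrier] by blast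
    then show ?thesis by (simp add: add_pow_int_ge)
  qed
  show ?thesis
  proof (induction c rule: int_induct[where k = 0])
    case base
    show ?case by (rule zero)
  next
    case (step1 i)
    show ?case unfolding step step' step1.IH ..
  next
    case (step2 i)
    \<comment> \<open>Going down, the two sides agree after adding \<open>?X\<close>, which is then
      cancelled.\<close>
    have "class_A (\<lambda>p. of_int (i - 1) * x p) \<oplus>\<^bsub>ring_A\<^esub> ?X =
        [(i - 1)] \<cdot>\<^bsub>ring_A\<^esub> ?X \<oplus>\<^bsub>ring_A\<^esub> ?X"
      using step[of "i - 1"] step'[of "i - 1"] step2.IH unfolding diff_add_cancel by metis
    then show ?case
      using A.add.right_cancel[OF X class_A_carrier carr] by blast
  qed
qed

section \<open>Congruences between mixed sums and their classes\<close>

lemma rat_cong_mixed_sum: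
  assumes "prime p" "length es = r"
  shows "rat_cong p (mixed_sum p (replicate r 1) es) (mixed_sum p (replicate r 1) es)"
  unfolding assms(2)[symmetric] mixed_sum_eq_nested_sum
  by (intro rat_cong_nested_sum assms(1))
    (auto simp: list_all2_conv_all_nth intro: rat_cong_weight assms(1))

text \<open>Replace the weights of sign -1 by reflected ones modulo p, then apply the exact identity
  for the resulting nested sum.\<close>

lemma mixed_sum_cong_E:
  assumes "prime p" "odd p"
  shows "rat_cong p
    (mixed_sum p (replicate (Suc u + s) 1) (replicate (Suc u) 1 @ replicate s (-1)))
    (of_int ((-1) ^ s * int ((Suc u + s) choose s)) *
      mixed_sum p (replicate (Suc u + s) 1) (replicate (Suc u + s) 1))"
proof -
  have E: "mixed_sum p (replicate (Suc u + s) 1) (replicate (Suc u + s) 1) =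
      nested_sum 0 p (replicate (Suc u + s) (weight 1))"
    using mixed_sum_eq_nested_sum[of p "replicate (Suc u + s) 1"]
    by (simp del: replicate_Suc)
  have M: "mixed_sum p (replicate (Suc u + s) 1) (replicate (Suc u) 1 @ replicate s (-1)) =
      nested_sum 0 p (replicate (Suc u) (weight 1) @ replicate s (weight (-1)))"
    using mixed_sum_eq_nested_sum[of p "replicate (Suc u) 1 @ replicate s (-1)"]
    by (simp del: replicate_Suc)
  have "rat_cong p (nested_sum 0 p (replicate (Suc u) (weight 1) @ replicate s (weight (-1))))
    (nested_sum 0 p (replicate (Suc u) (weight 1) @ replicate s (\<lambda>m. - weight 1 (p - m))))"
    by (intro rat_cong_nested_sum assms list_all2_appendI)
      (auto simp: list_all2_conv_all_nth simp del: replicate_Suc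
        intro: rat_cong_weight rat_cong_weight_reflect[OF assms] assms(1))
  then show ?thesis
    unfolding E M nested_sum_weight_reflected_weight[OF assms(2)] by simp
qed

text \<open>Here every index is reflected, so the range 0 < m < p is mapped onto itself.\<close>

lemma mixed_sum_cong_t:
  assumes "prime p" "odd p"
  shows "rat_cong p (mixed_sum p (replicate r 1) (replicate r (-1)))
    (of_int ((-1) ^ r) * mixed_sum p (replicate r 1) (replicate r 1))"
proof -
  have eq: "mixed_sum p (replicate r 1) (replicate r e) = nested_sum 0 p (replicate r (weight e))"
    for e using mixed_sum_eq_nested_sum[of p "replicate r e"] by simp
  have "rat_cong p (nested_sum 0 p (replicate r (weight (-1))))
      (nested_sum 0 p (replicate r (\<lambda>m. - weight 1 (p - m))))"
    by (intro rat_cong_nested_sum assms)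
      (auto simp: list_all2_conv_all_nth intro: rat_cong_weight_reflect[OF assms])
  then show ?thesis
    unfolding eq by (simp add: nested_sum_reflected_weight nested_sum_weight_1)
qed

text \<open>The only possible exception is p = 2, and classes in the quotient ignore finitely many
  primes.\<close>

lemma finite_primes_if_odd:
  assumes "\<And>p. prime p \<Longrightarrow> odd p \<Longrightarrow> P p"
  shows "finite {p :: nat. prime p \<and> \<not> P p}"
  by (rule finite_subset[of _ "{2}"]) (use assms prime_odd_nat prime_ge_2_nat in \<open>auto simp: order_le_less\<close>)

theorem mainTheorem7:
  fixes a m :: nat
  assumes "m \<le> a"
  shows "M_A (replicate (a + 2) 1) (replicate (a - m + 1) 1 @ replicate (m + 1) (-1)) =
           [((-1) ^ (m + 1) * int ((a + 2) choose (m + 1)))] \<cdot>\<^bsub>ring_A\<^esub> E_A (replicate (a + 2) 1) \<and>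
         M_A (replicate (a + 2) 1) (replicate (a - m + 1) 1 @ replicate (m + 1) (-1)) =
           [((-1) ^ (a + m + 1) * int ((a + 2) choose (m + 1)))] \<cdot>\<^bsub>ring_A\<^esub> t_A (replicate (a + 2) 1)"
proof -
  interpret A: cring ring_A by (rule cring_ring_A)
  let ?ks = "replicate (a + 2) 1"
  let ?b = "int ((a + 2) choose (m + 1))"
  \<comment> \<open>The congruence is used with u = a - m and s = m + 1; m \<le> a makes the
    subtraction exact.\<close>
  have r: "Suc (a - m) + (m + 1) = a + 2" and u: "a - m + 1 = Suc (a - m)"
    using assms by simp_all
  have integral: "finite {p. prime p \<and> \<not> rat_cong p (mixed_sum p ?ks es) (mixed_sum p ?ks es)}"
    if "length es = a + 2" for es
    by (intro finite_primes_if_odd rat_cong_mixed_sum that)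
  have ME: "M_A ?ks (replicate (a - m + 1) 1 @ replicate (m + 1) (-1)) =
      [((-1) ^ (m + 1) * ?b)] \<cdot>\<^bsub>ring_A\<^esub> E_A ?ks"
  proof -
    have "M_A ?ks (replicate (a - m + 1) 1 @ replicate (m + 1) (-1)) =
        class_A (\<lambda>p. of_int ((-1) ^ (m + 1) * ?b) * mixed_sum p ?ks (replicate (a + 2) 1))"
      unfolding M_A_def u
      by (intro class_A_cong finite_primes_if_odd mixed_sum_cong_E[where u = "a - m" and s = "m + 1", unfolded r])
    also have "\<dots> = [((-1) ^ (m + 1) * ?b)] \<cdot>\<^bsub>ring_A\<^esub> E_A ?ks"
      unfolding M_A_def E_A_def length_replicate by (intro class_A_int_mult integral) simp
    finally show ?thesis .
  qed
  have tE: "t_A ?ks = [((-1) ^ (a + 2) :: int)] \<cdot>\<^bsub>ring_A\<^esub> E_A ?ks"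
  proof -
    have "t_A ?ks = class_A (\<lambda>p. of_int ((-1) ^ (a + 2)) * mixed_sum p ?ks (replicate (a + 2) 1))"
      unfolding M_A_def t_A_def length_replicate
      by (intro class_A_cong finite_primes_if_odd mixed_sum_cong_t)
    also have "\<dots> = [((-1) ^ (a + 2) :: int)] \<cdot>\<^bsub>ring_A\<^esub> E_A ?ks"
      unfolding M_A_def E_A_def length_replicate by (intro class_A_int_mult integral) simp
    finally show ?thesis .
  qed
  \<comment> \<open>The second formula follows from the first by writing t as a signed multiple of
    E.\<close>
  have "E_A ?ks \<in> carrier ring_A"
    by (simp add: E_A_def M_A_def class_A_carrier)
  then have "[((-1) ^ (a + m + 1) * ?b)] \<cdot>\<^bsub>ring_A\<^esub> t_A ?ks =
      [((-1) ^ (a + 2) * ((-1) ^ (a + m + 1) * ?b))] \<cdot>\<^bsub>ring_A\<^esub> E_A ?ks"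
    unfolding tE by (rule A.add.int_pow_pow)
  \<comment> \<open>The exponents add up to 2(a + 1) + (m + 1), so the sign is that of the first
    formula.\<close>
  also have "(-1) ^ (a + 2) * ((-1) ^ (a + m + 1) * ?b) = (-1) ^ (m + 1) * ?b"
    by (simp add: power_add mult_ac flip: power_mult_distrib)
  finally show ?thesis using ME by simp
qed

end
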